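(* $\kappa(\mathbb{L})\le\mathfrak{h}$ and $\kappa(\mathbb{M})\le\mathfrak{h}$.
   Context: A tree on ${}^{<\omega}\omega$ is a nonempty subset closed under initial segments; $Succ_p(s)=\{n:s^\frown n\in p\}$. Laver forcing $\mathbb{L}$ is the set of trees $p$ with a stem (maximal node comparable with all nodes) such that $Succ_p(s)$ is infinite for all $s\in p$ extending the stem; Miller forcing $\mathbb{M}$ is the set of trees $p$ with a stem such that every $s\in p$ has an extension $t\in p$ with $Succ_p(t)$ infinite; both ordered by inclusion. For a forcing $P$, $\kappa(P)$ is the least cardinal to which forcing with $P$ collapses the continuum, i.e. the least cardinal $\kappa$ such that $P$ forces that there is a surjection from $\kappa$ onto $\mathfrak{c}$ of the ground model. $\mathfrak{h}$ is the least cardinality of a family of maximal antichains of $\mathcal{P}(\omega)/\mathrm{fin}$ without a common refinement. *)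

theory Defs
  imports "HOL-Library.Sublist" "HOL-Library.Infinite_Set"
begin

unbundle cardinal_syntax

section \<open>Least cardinals\<close>

text \<open>Cardinals are cardinal orders, compared across types by \<open>\<le>o\<close>. A least element of a set of
  cardinals is unique up to \<open>=o\<close>.\<close>

definition least_card :: "'a rel set \<Rightarrow> 'a rel" where
  "least_card C = (SOME r. r \<in> C \<and> (\<forall>r'\<in>C. r \<le>o r'))"

lemma least_card:
  assumes "C \<noteq> {}" and "\<forall>r\<in>C. Card_order r"
  shows "least_card C \<in> C" and "r \<in> C \<Longrightarrow> least_card C \<le>o r"
proof -
  have "\<forall>r\<in>C. Well_order r"
    using assms(2) by (auto simp: card_order_on_def)
  then have "\<exists>r. r \<in> C \<and> (\<forall>r'\<in>C. r \<le>o r')"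
    using exists_minim_Well_order[of C] assms(1) by blast
  then have *: "least_card C \<in> C \<and> (\<forall>r'\<in>C. least_card C \<le>o r')"
    unfolding least_card_def by (rule someI_ex)
  then show "least_card C \<in> C" and "r \<in> C \<Longrightarrow> least_card C \<le>o r"
    by blast+
qed


section \<open>The Boolean algebra of sets of natural numbers modulo finite sets\<close>

quotient_type pfin = "nat set" / "\<lambda>A B. finite ((A - B) \<union> (B - A))"
proof (rule equivpI)
  show "reflp (\<lambda>A B :: nat set. finite ((A - B) \<union> (B - A)))"
    by (auto intro: reflpI)
  show "symp (\<lambda>A B :: nat set. finite ((A - B) \<union> (B - A)))"
    by (auto intro: sympI)
  show "transp (\<lambda>A B :: nat set. finite ((A - B) \<union> (B - A)))"
  proof (rule transpI)
    fix A B C :: "nat set"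
    assume "finite ((A - B) \<union> (B - A))" and "finite ((B - C) \<union> (C - B))"
    then have "finite (((A - B) \<union> (B - A)) \<union> ((B - C) \<union> (C - B)))"
      by simp
    then show "finite ((A - C) \<union> (C - A))"
      by (rule finite_subset[rotated]) blast
  qed
qed

instantiation pfin :: boolean_algebra
begin

lift_definition bot_pfin :: pfin is "{}" .

lift_definition top_pfin :: pfin is UNIV .

lift_definition uminus_pfin :: "pfin \<Rightarrow> pfin" is uminus
  by (erule finite_subset[rotated]) blast

lift_definition inf_pfin :: "pfin \<Rightarrow> pfin \<Rightarrow> pfin" is "(\<inter>)"
  by (drule (1) finite_UnI, erule finite_subset[rotated]) blast

lift_definition sup_pfin :: "pfin \<Rightarrow> pfin \<Rightarrow> pfin" is "(\<union>)"
  by (drule (1) finite_UnI, erule finite_subset[rotated]) blast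

lift_definition minus_pfin :: "pfin \<Rightarrow> pfin \<Rightarrow> pfin" is "(-)"
  by (drule (1) finite_UnI, erule finite_subset[rotated]) blast

lift_definition less_eq_pfin :: "pfin \<Rightarrow> pfin \<Rightarrow> bool" is "\<lambda>A B. finite (A - B)"
proof -
  fix A A' B B' :: "nat set"
  assume "finite ((A - A') \<union> (A' - A))" and "finite ((B - B') \<union> (B' - B))"
  then have *: "finite (((A - A') \<union> (A' - A)) \<union> ((B - B') \<union> (B' - B)))" (is "finite ?D")
    by simp
  have "finite (A' - B')" if "finite (A - B)"
    by (rule finite_subset[of _ "?D \<union> (A - B)"]) (use * that in auto)
  moreover have "finite (A - B)" if "finite (A' - B')"
    by (rule finite_subset[of _ "?D \<union> (A' - B')"]) (use * that in auto)
  ultimately show "finite (A - B) = finite (A' - B')"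
    by blast
qed

definition less_pfin :: "pfin \<Rightarrow> pfin \<Rightarrow> bool" where
  "less_pfin x y \<longleftrightarrow> x \<le> y \<and> \<not> y \<le> x"

instance
proof
  fix x y z :: pfin
  show "(x < y) = (x \<le> y \<and> \<not> y \<le> x)"
    by (rule less_pfin_def)
  show "x \<le> x"
    by transfer simp
  show "x \<le> z" if "x \<le> y" "y \<le> z"
    using that by transfer (drule (1) finite_UnI, erule finite_subset[rotated], blast)
  show "x = y" if "x \<le> y" "y \<le> x"
    using that by transfer simp
  show "inf x y \<le> x"
    by transfer (rule finite_subset[of _ "{}"], auto)
  show "inf x y \<le> y"
    by transfer (rule finite_subset[of _ "{}"], auto)
  show "x \<le> inf y z" if "x \<le> y" "x \<le> z"
    using that by transfer (drule (1) finite_UnI, erule finite_subset[rotated], blast)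
  show "x \<le> sup x y"
    by transfer (rule finite_subset[of _ "{}"], auto)
  show "y \<le> sup x y"
    by transfer (rule finite_subset[of _ "{}"], auto)
  show "sup y z \<le> x" if "y \<le> x" "z \<le> x"
    using that by transfer (drule (1) finite_UnI, erule finite_subset[rotated], blast)
  show "bot \<le> x"
    by transfer simp
  show "x \<le> top"
    by transfer simp
  show "sup x (inf y z) = inf (sup x y) (sup x z)"
    by transfer (rule finite_subset[of _ "{}"], auto)
  show "inf x (- x) = bot"
    by transfer simp
  show "sup x (- x) = top"
    by transfer simp
  show "x - y = inf x (- y)"
    by transfer (rule finite_subset[of _ "{}"], auto)
qed

end


section \<open>The cardinal \<open>\<hh>\<close>\<close>

definition antichain :: "'a::boolean_algebra set \<Rightarrow> bool" where
  "antichain A \<longleftrightarrow> bot \<notin> A \<and> (\<forall>a\<in>A. \<forall>b\<in>A. a \<noteq> b \<longrightarrow> inf a b = bot)"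

definition max_antichain :: "'a::boolean_algebra set \<Rightarrow> bool" where
  "max_antichain A \<longleftrightarrow> antichain A \<and> (\<forall>B. antichain B \<longrightarrow> A \<subseteq> B \<longrightarrow> B = A)"

definition refines :: "'a::boolean_algebra set \<Rightarrow> 'a set \<Rightarrow> bool" where
  "refines A B \<longleftrightarrow> (\<forall>a\<in>A. \<exists>b\<in>B. a \<le> b)"

definition common_refinement :: "'a::boolean_algebra set \<Rightarrow> 'a set set \<Rightarrow> bool" where
  "common_refinement R H \<longleftrightarrow> max_antichain R \<and> (\<forall>A\<in>H. refines R A)"

definition cardinal_h :: "pfin set rel" ("\<hh>") where
  "\<hh> = least_card {|H| | H :: pfin set set.
     (\<forall>A\<in>H. max_antichain A) \<and> (\<nexists>R. common_refinement R H)}"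


section \<open>The forcing relation\<close>

text \<open>Statements of the forcing language are represented by the set of conditions forcing them,
  so the clauses of the recursive definition of the forcing relation become operations on
  predicates on conditions. Negation, conjunction and the existential quantifier are primitive.
  Existential quantification is over a ground model class of names for the objects in question: the
  check names of the elements of a ground model set, or the names for subsets of a ground model set.
  A name \<open>{(\<check>a, p), \<dots>}\<close> for a subset of a ground model set is represented as a set of
  pairs of type \<open>'a \<times> 'p\<close>; every subset, in the extension, of a ground model set has such a name.\<close>

type_synonym 'p statement = "'p \<Rightarrow> bool"

context
  fixes P :: "'p set" and le :: "'p \<Rightarrow> 'p \<Rightarrow> bool"
begin

definition dense_below :: "('p \<Rightarrow> bool) \<Rightarrow> 'p \<Rightarrow> bool" where
  "dense_below D p \<longleftrightarrow> (\<forall>q\<in>P. le q p \<longrightarrow> (\<exists>r\<in>P. le r q \<and> D r))"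

definition names :: "'a set \<Rightarrow> ('a \<times> 'p) set set" where
  "names A = Pow (A \<times> P)"

definition fmem :: "'a \<Rightarrow> ('a \<times> 'p) set \<Rightarrow> 'p statement" where
  "fmem a \<tau> = dense_below (\<lambda>q. \<exists>s. (a, s) \<in> \<tau> \<and> le q s)"

text \<open>Equality of check names is decided by the ground model.\<close>

definition feq :: "'a \<Rightarrow> 'a \<Rightarrow> 'p statement" where
  "feq a b = (\<lambda>p. a = b)"

definition fnot :: "'p statement \<Rightarrow> 'p statement" where
  "fnot \<phi> = (\<lambda>p. \<not> (\<exists>q\<in>P. le q p \<and> \<phi> q))"

definition fand :: "'p statement \<Rightarrow> 'p statement \<Rightarrow> 'p statement" where
  "fand \<phi> \<psi> = (\<lambda>p. \<phi> p \<and> \<psi> p)"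

definition fex :: "'x set \<Rightarrow> ('x \<Rightarrow> 'p statement) \<Rightarrow> 'p statement" where
  "fex X \<phi> = dense_below (\<lambda>q. \<exists>x\<in>X. \<phi> x q)"

definition fimp :: "'p statement \<Rightarrow> 'p statement \<Rightarrow> 'p statement" where
  "fimp \<phi> \<psi> = fnot (fand \<phi> (fnot \<psi>))"

definition fall :: "'x set \<Rightarrow> ('x \<Rightarrow> 'p statement) \<Rightarrow> 'p statement" where
  "fall X \<phi> = fnot (fex X (\<lambda>x. fnot (\<phi> x)))"

definition ffunction :: "'a set \<Rightarrow> 'b set \<Rightarrow> (('a \<times> 'b) \<times> 'p) set \<Rightarrow> 'p statement" where
  "ffunction A B f =
     fand (fall A (\<lambda>a. fex B (\<lambda>b. fmem (a, b) f)))
          (fall A (\<lambda>a. fall B (\<lambda>b. fall B (\<lambda>b'.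
             fimp (fand (fmem (a, b) f) (fmem (a, b') f)) (feq b b')))))"

definition fsurjection :: "'a set \<Rightarrow> 'b set \<Rightarrow> (('a \<times> 'b) \<times> 'p) set \<Rightarrow> 'p statement" where
  "fsurjection A B f =
     fand (ffunction A B f) (fall B (\<lambda>b. fex A (\<lambda>a. fmem (a, b) f)))"

definition forced :: "'p statement \<Rightarrow> bool" where
  "forced \<phi> \<longleftrightarrow> (\<forall>p\<in>P. \<phi> p)"

definition collapses :: "'b rel \<Rightarrow> 'a rel \<Rightarrow> bool" where
  "collapses c r \<longleftrightarrow>
     forced (fex (names (Field r \<times> Field c)) (fsurjection (Field r) (Field c)))"

text \<open>The cardinals in question are at most the continuum, so it suffices to consider cardinal
  orders on sets of subsets of \<open>\<omega>\<close>.\<close>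

definition kappa :: "nat set rel" where
  "kappa = least_card {r :: nat set rel. Card_order r \<and> collapses |UNIV :: nat set set| r}"

end


section \<open>Laver and Miller forcing\<close>

definition tree :: "nat list set \<Rightarrow> bool" where
  "tree p \<longleftrightarrow> p \<noteq> {} \<and> (\<forall>t\<in>p. \<forall>s. prefix s t \<longrightarrow> s \<in> p)"

definition Succ :: "nat list set \<Rightarrow> nat list \<Rightarrow> nat set" where
  "Succ p s = {n. s @ [n] \<in> p}"

definition comparable_node :: "nat list set \<Rightarrow> nat list \<Rightarrow> bool" where
  "comparable_node p s \<longleftrightarrow> s \<in> p \<and> (\<forall>t\<in>p. prefix s t \<or> prefix t s)"

definition is_stem :: "nat list set \<Rightarrow> nat list \<Rightarrow> bool" where
  "is_stem p s \<longleftrightarrow>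
     comparable_node p s \<and> (\<forall>t. comparable_node p t \<longrightarrow> prefix s t \<longrightarrow> t = s)"

definition laver :: "nat list set set" where
  "laver = {p. tree p \<and> (\<exists>s. is_stem p s \<and> (\<forall>t\<in>p. prefix s t \<longrightarrow> infinite (Succ p t)))}"

definition miller :: "nat list set set" where
  "miller = {p. tree p \<and> (\<exists>s. is_stem p s) \<and>
     (\<forall>s\<in>p. \<exists>t\<in>p. prefix s t \<and> infinite (Succ p t))}"


section \<open>The least cardinals exist\<close>

lemma collapses_refl:
  assumes refl: "\<And>p. p \<in> P \<Longrightarrow> le p p" and trans: "\<And>p q r. le p q \<Longrightarrow> le q r \<Longrightarrow> le p r"
  shows "collapses P le r r"
proof -
  let ?f = "{((a, a), p) | a p. a \<in> Field r \<and> p \<in> P}"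
  have allI': "\<And>p. p \<in> P \<Longrightarrow> fall P le X \<phi> p" if "\<And>x p. x \<in> X \<Longrightarrow> p \<in> P \<Longrightarrow> \<phi> x p"
    for X :: "'x set" and \<phi>
    unfolding fall_def fex_def dense_below_def fnot_def using that refl by meson
  have impI': "\<And>p. p \<in> P \<Longrightarrow> fimp P le \<phi> \<psi> p" if "\<And>p. p \<in> P \<Longrightarrow> \<phi> p \<Longrightarrow> \<psi> p" for \<phi> \<psi>
    unfolding fimp_def fand_def fnot_def using that refl by meson
  have mem: "fmem P le (a, b) ?f p \<longleftrightarrow> a = b" if "p \<in> P" "a \<in> Field r" for a b p
    using that refl trans unfolding fmem_def dense_below_def by blast
  have total: "fex P le (Field r) (\<lambda>b. fmem P le (a, b) ?f) p"
    and onto: "fex P le (Field r) (\<lambda>b. fmem P le (b, a) ?f) p" if "p \<in> P" "a \<in> Field r" for a p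
    unfolding fex_def dense_below_def using that refl mem by blast+
  have "fsurjection P le (Field r) (Field r) ?f p" if "p \<in> P" for p
    unfolding fsurjection_def ffunction_def fand_def
    by (intro conjI allI' impI' that total onto) (auto simp: mem feq_def)
  moreover have "?f \<in> names P (Field r \<times> Field r)"
    by (auto simp: names_def)
  ultimately show ?thesis
    unfolding collapses_def forced_def fex_def dense_below_def using refl by blast
qed

lemma kappa_welldefined:
  assumes "\<And>p. p \<in> P \<Longrightarrow> le p p" and "\<And>p q r. le p q \<Longrightarrow> le q r \<Longrightarrow> le p r"
  shows "Card_order (kappa P le)" "collapses P le |UNIV :: nat set set| (kappa P le)"
    and "Card_order r \<Longrightarrow> collapses P le |UNIV :: nat set set| r \<Longrightarrow> kappa P le \<le>o (r :: nat set rel)"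
proof -
  let ?C = "{r :: nat set rel. Card_order r \<and> collapses P le |UNIV :: nat set set| r}"
  have "collapses P le |UNIV :: nat set set| |UNIV :: nat set set|"
    by (rule collapses_refl) (fact assms(1), fact assms(2))
  then have "|UNIV :: nat set set| \<in> ?C"
    using card_of_Card_order by simp
  then have ne: "?C \<noteq> {}"
    by blast
  have card: "\<forall>r\<in>?C. Card_order r"
    by simp
  note * = least_card[OF ne card, folded kappa_def]
  show "Card_order (kappa P le)" "collapses P le |UNIV :: nat set set| (kappa P le)"
    using *(1) by simp_all
  show "kappa P le \<le>o r" if "Card_order r" "collapses P le |UNIV :: nat set set| r"
    using *(2) that by simp
qed

lemma pfin_split:
  fixes x :: pfin
  assumes "x \<noteq> bot"
  obtains y where "y \<noteq> bot" "\<not> x \<le> y" "\<not> x \<le> - y"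
proof -
  have "\<exists>y :: pfin. y \<noteq> bot \<and> \<not> x \<le> y \<and> \<not> x \<le> - y"
    using assms
  proof transfer
    fix A :: "nat set"
    assume "\<not> finite (A - {} \<union> ({} - A))"
    then have inf: "infinite A"
      by simp
    let ?B = "enumerate A ` {n. even n}"
    have inj: "inj (enumerate A)"
      using inf by (simp add: strict_mono_enumerate strict_mono_imp_inj_on)
    have evens: "infinite {n :: nat. even n}" "infinite {n :: nat. odd n}"
      unfolding infinite_nat_iff_unbounded_le
      by (metis even_Suc le_SucI mem_Collect_eq order_refl)+
    have "?B \<subseteq> A" "enumerate A ` {n. odd n} \<subseteq> A - ?B"
      using inf enumerate_in_set inj by (auto simp: inj_eq)
    moreover have "infinite ?B" "infinite (enumerate A ` {n. odd n})"
      using evens inj by (meson finite_imageD inj_on_subset subset_UNIV)+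
    ultimately have "?B \<subseteq> A \<and> infinite ?B \<and> infinite (A - ?B)"
      by (meson finite_subset)
    then obtain B where B: "B \<subseteq> A" "infinite B" "infinite (A - B)"
      by blast
    then have "A - - B = B"
      by blast
    with B show "\<exists>B. \<not> finite (B - {} \<union> ({} - B)) \<and> \<not> finite (A - B) \<and> \<not> finite (A - - B)"
      by (intro exI[of _ B]) simp
  qed
  with that show ?thesis
    by blast
qed

lemma cardinal_h_welldefined:
  fixes H :: "pfin set set"
  shows "\<exists>H. (\<forall>A\<in>H. max_antichain A) \<and> (\<nexists>R. common_refinement R H) \<and> \<hh> = |H|"
    and "\<lbrakk>\<forall>A\<in>H. max_antichain A; \<nexists>R. common_refinement R H\<rbrakk> \<Longrightarrow> \<hh> \<le>o |H|"
proof -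
  let ?C = "{|H| | H :: pfin set set. (\<forall>A\<in>H. max_antichain A) \<and> (\<nexists>R. common_refinement R H)}"
  have "\<nexists>R. common_refinement R {A :: pfin set. max_antichain A}"
  proof
    assume "\<exists>R. common_refinement R {A :: pfin set. max_antichain A}"
    then obtain R :: "pfin set" where R: "max_antichain R"
      and ref: "\<And>A. max_antichain A \<Longrightarrow> refines R A"
      by (auto simp: common_refinement_def)
    have "R \<noteq> {}"
    proof
      assume "R = {}"
      moreover have "antichain {top :: pfin}"
        by (simp add: antichain_def) (transfer, simp)
      ultimately show False
        using R by (auto simp: max_antichain_def)
    qed
    then obtain x where x: "x \<in> R" "x \<noteq> bot"
      using R by (auto simp: max_antichain_def antichain_def)
    then obtain y where y: "y \<noteq> bot" "\<not> x \<le> y" "\<not> x \<le> - y"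
      by (metis pfin_split)
    have "- y \<noteq> bot"
      using y(2) by (metis compl_bot_eq double_compl top_greatest)
    have "max_antichain {y, - y}"
      unfolding max_antichain_def
    proof (intro conjI allI impI)
      show "antichain {y, - y}"
        using y(1) \<open>- y \<noteq> bot\<close> by (auto simp: antichain_def)
      fix B
      assume B: "antichain B" "{y, - y} \<subseteq> B"
      have "b \<in> {y, - y}" if "b \<in> B" for b
      proof (rule ccontr)
        assume "b \<notin> {y, - y}"
        then have "inf b y = bot" "inf b (- y) = bot"
          using B that by (auto simp: antichain_def)
        then have "b = bot"
          by (metis inf_sup_distrib1 inf_top_right sup_bot.right_neutral sup_compl_top)
        then show False
          using B that by (auto simp: antichain_def)
      qed
      with B show "B = {y, - y}"
        by blast
    qed
    then show False
      using ref x y by (force simp: refines_def)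
  qed
  then have "|{A :: pfin set. max_antichain A}| \<in> ?C"
    by blast
  then have ne: "?C \<noteq> {}"
    by blast
  have card: "\<forall>r\<in>?C. Card_order r"
    using card_of_Card_order by fast
  note * = least_card[OF ne card, folded cardinal_h_def]
  show "\<exists>H. (\<forall>A\<in>H. max_antichain A) \<and> (\<nexists>R. common_refinement R H) \<and> \<hh> = |H|"
    using *(1) by (elim CollectE exE conjE) (intro exI conjI)
  show "\<hh> \<le>o |H|" if "\<forall>A\<in>H. max_antichain A" "\<nexists>R. common_refinement R H"
    by (rule *(2)) (intro CollectI exI[of _ H] conjI refl that)
qed

end

theory Submission
  imports Defs "HOL-Library.Countable_Set"
begin

text \<open>Let \<open>H\<close> witness \<open>\<hh>\<close>. Below some \<open>x0\<close> every nonzero element is split by an antichain in \<open>H\<close>. By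
  minimality of \<open>H\<close> there are maximal antichains \<open>\<R> C\<close>, indexed by \<open>C \<in> H\<close>, such that every countable
  subset of \<open>H\<close> is refined by one of them. Hence, for any countable family of nonzero elements below
  \<open>x0\<close>, some \<open>\<R> C\<close> has continuum many elements meeting each member of the family. By a Bernstein
  construction, \<open>\<R> C\<close> can be coloured with continuum many colours so that each element meeting
  continuum many members of \<open>\<R> C\<close> meets members of all colours.

  Transport the successor sets of a tree below \<open>x0\<close>. Given a tree \<open>p\<close> and a colour \<open>z\<close>, choose \<open>C\<close> for the
  countable family of its infinite successor sets and shrink each of them into a member of \<open>\<R> C\<close> of
  colour \<open>z\<close>. Compatible trees obtained in this way for the same \<open>C\<close> have the same colour, so the
  generic filter defines a partial function from \<open>H\<close> to the set of colours, and by density it is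
  onto.\<close>


section \<open>Forcing a surjection\<close>

locale forcing_order =
  fixes P :: "'p set" and le :: "'p \<Rightarrow> 'p \<Rightarrow> bool"
  assumes le_refl: "p \<in> P \<Longrightarrow> le p p"
    and le_trans: "\<lbrakk>le p q; le q r\<rbrakk> \<Longrightarrow> le p r"
begin

lemma fallI:
  assumes "\<And>x q. \<lbrakk>x \<in> X; q \<in> P; le q p\<rbrakk> \<Longrightarrow> \<phi> x q"
  shows "fall P le X \<phi> p"
  unfolding fall_def fex_def dense_below_def fnot_def
  using assms le_refl le_trans by meson

lemma fimpI:
  assumes "\<And>q. \<lbrakk>q \<in> P; le q p; \<phi> q\<rbrakk> \<Longrightarrow> \<psi> q"
  shows "fimp P le \<phi> \<psi> p"
  unfolding fimp_def fand_def fnot_def using assms le_refl by meson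

lemma fexI:
  assumes "\<And>q. q \<in> P \<Longrightarrow> \<exists>r\<in>P. le r q \<and> (\<exists>x\<in>X. \<phi> x r)"
  shows "fex P le X \<phi> p"
  unfolding fex_def dense_below_def using assms by blast

lemma dense_below_mono: "\<lbrakk>dense_below P le D p; le q p\<rbrakk> \<Longrightarrow> dense_below P le D q"
  unfolding dense_below_def using le_trans by blast

lemma fsurjectionI:
  assumes total: "\<And>a p. \<lbrakk>a \<in> A; p \<in> P\<rbrakk> \<Longrightarrow> \<exists>q\<in>P. le q p \<and> (\<exists>b\<in>B. fmem P le (a, b) f q)"
    and unique: "\<And>a b b' p. \<lbrakk>a \<in> A; b \<in> B; b' \<in> B; p \<in> P;
      fmem P le (a, b) f p; fmem P le (a, b') f p\<rbrakk> \<Longrightarrow> b = b'"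
    and onto: "\<And>b p. \<lbrakk>b \<in> B; p \<in> P\<rbrakk> \<Longrightarrow> \<exists>q\<in>P. le q p \<and> (\<exists>a\<in>A. fmem P le (a, b) f q)"
  shows "fsurjection P le A B f p"
  unfolding fsurjection_def ffunction_def fand_def feq_def
proof (intro conjI)
  show "fall P le A (\<lambda>a. fex P le B (\<lambda>b. fmem P le (a, b) f)) p"
    by (intro fallI fexI total)
  show "fall P le A (\<lambda>a. fall P le B (\<lambda>b. fall P le B (\<lambda>b'.
      fimp P le (\<lambda>p. fmem P le (a, b) f p \<and> fmem P le (a, b') f p) (\<lambda>p. b = b')))) p"
    by (intro fallI fimpI) (blast intro: unique)
  show "fall P le B (\<lambda>b. fex P le A (\<lambda>a. fmem P le (a, b) f)) p"
    by (intro fallI fexI onto)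
qed

lemma collapsesI:
  assumes "f \<in> names P (Field r \<times> Field c)"
    and "\<And>p. p \<in> P \<Longrightarrow> fsurjection P le (Field r) (Field c) f p"
  shows "collapses P le c r"
  unfolding collapses_def forced_def using assms le_refl by (blast intro: fexI)

definition name_of :: "'x set \<Rightarrow> ('x \<Rightarrow> 'p statement) \<Rightarrow> ('x \<times> 'p) set" where
  "name_of X \<phi> = {(x, p). x \<in> X \<and> p \<in> P \<and> \<phi> x p}"

lemma name_of_in_names: "name_of X \<phi> \<in> names P X"
  by (auto simp: name_of_def names_def)

lemma fmem_name_of_iff:
  assumes "x \<in> X" and "\<And>p q. \<lbrakk>p \<in> P; q \<in> P; \<phi> x q; le p q\<rbrakk> \<Longrightarrow> \<phi> x p"
  shows "fmem P le x (name_of X \<phi>) p \<longleftrightarrow> dense_below P le (\<phi> x) p"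
  unfolding fmem_def dense_below_def name_of_def using assms le_refl by blast

lemma kappa_le_if_collapses:
  fixes r :: "nat set rel"
  assumes "Card_order r" and "collapses P le |UNIV :: nat set set| r"
  shows "kappa P le \<le>o r"
  by (rule kappa_welldefined(3)[OF le_refl le_trans assms])

lemma kappa_le_continuum: "kappa P le \<le>o |UNIV :: nat set set|"
  by (rule kappa_le_if_collapses[OF card_of_Card_order collapses_refl[OF le_refl le_trans]])

end

text \<open>\<open>V a b q\<close> says that \<open>q\<close> decides the value at \<open>a\<close> of a partial function from \<open>A\<close> onto \<open>B\<close> in
  the extension to be \<open>b\<close>.\<close>

locale decided_surjection = forcing_order P le
  for P :: "'p set" and le :: "'p \<Rightarrow> 'p \<Rightarrow> bool" +
  fixes A :: "'a set" and B :: "'b set" and V :: "'a \<Rightarrow> 'b \<Rightarrow> 'p statement"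
  assumes decided_mono: "\<lbrakk>a \<in> A; p \<in> P; q \<in> P; V a b q; le p q\<rbrakk> \<Longrightarrow> V a b p"
    and decided_unique: "\<lbrakk>a \<in> A; p \<in> P; V a b p; V a b' p\<rbrakk> \<Longrightarrow> b = b'"
    and decided_onto: "\<lbrakk>b \<in> B; p \<in> P\<rbrakk> \<Longrightarrow> \<exists>q\<in>P. le q p \<and> (\<exists>a\<in>A. V a b q)"
begin

abbreviation graph_name :: "(('a \<times> 'b) \<times> 'p) set" where
  "graph_name \<equiv> name_of (A \<times> B) (\<lambda>(a, b). V a b)"

lemma fmem_graph_name_iff:
  assumes "a \<in> A" "b \<in> B"
  shows "fmem P le (a, b) graph_name p \<longleftrightarrow> dense_below P le (V a b) p"
  using fmem_name_of_iff[of "(a, b)" "A \<times> B" "\<lambda>(a, b). V a b" p] assms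
  by (auto intro: decided_mono)

lemma fmem_graph_nameI:
  assumes "a \<in> A" "b \<in> B" "p \<in> P" "V a b p"
  shows "fmem P le (a, b) graph_name p"
  using assms le_refl decided_mono unfolding fmem_graph_name_iff[OF assms(1,2)] dense_below_def
  by blast

lemma fsurjection_graph_name:
  assumes total: "\<And>a p. \<lbrakk>a \<in> A; p \<in> P\<rbrakk> \<Longrightarrow> \<exists>q\<in>P. le q p \<and> (\<exists>b\<in>B. V a b q)"
  shows "fsurjection P le A B graph_name p"
proof (rule fsurjectionI)
  show "\<exists>q\<in>P. le q p \<and> (\<exists>b\<in>B. fmem P le (a, b) graph_name q)" if "a \<in> A" "p \<in> P" for a p
    using total[OF that] fmem_graph_nameI[OF that(1)] by blast
  show "\<exists>q\<in>P. le q p \<and> (\<exists>a\<in>A. fmem P le (a, b) graph_name q)" if "b \<in> B" "p \<in> P" for b p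
    using decided_onto[OF that] fmem_graph_nameI[OF _ that(1)] by blast
  show "b = b'"
    if ab: "a \<in> A" "b \<in> B" "b' \<in> B" and p: "p \<in> P"
      and mem: "fmem P le (a, b) graph_name p" "fmem P le (a, b') graph_name p" for a b b' p
  proof -
    have dense: "dense_below P le (V a b) p" "dense_below P le (V a b') p"
      using mem ab by (simp_all add: fmem_graph_name_iff)
    then obtain q where q: "q \<in> P" "le q p" "V a b q"
      using p le_refl unfolding dense_below_def by blast
    obtain r where r: "r \<in> P" "le r q" "V a b' r"
      using dense_below_mono[OF dense(2) q(2)] q(1) le_refl unfolding dense_below_def by blast
    have "V a b r"
      using decided_mono ab(1) q r by blast
    then show "b = b'"
      using decided_unique ab(1) r by blast
  qed
qed

definition undecided_below :: "'a \<Rightarrow> 'p statement" where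
  "undecided_below a p \<longleftrightarrow> (\<forall>q\<in>P. le q p \<longrightarrow> (\<forall>b\<in>B. \<not> V a b q))"

definition totalized :: "'b \<Rightarrow> 'a \<Rightarrow> 'b \<Rightarrow> 'p statement" where
  "totalized b0 a b p \<longleftrightarrow> b \<in> B \<and> V a b p \<or> b = b0 \<and> undecided_below a p"

lemma totalized_total:
  assumes "b0 \<in> B" "p \<in> P"
  shows "\<exists>q\<in>P. le q p \<and> (\<exists>b\<in>B. totalized b0 a b q)"
proof (cases "undecided_below a p")
  case True
  with assms show ?thesis
    using le_refl unfolding totalized_def by blast
next
  case False
  then show ?thesis
    unfolding undecided_below_def totalized_def by blast
qed

lemma decided_surjection_totalized: "decided_surjection P le A B (totalized b0)"
proof unfold_locales
  show "totalized b0 a b p" if "a \<in> A" "p \<in> P" "q \<in> P" "totalized b0 a b q" "le p q" for a b p q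
    using that decided_mono le_trans unfolding totalized_def undecided_below_def by blast
  show "b = b'" if "a \<in> A" "p \<in> P" "totalized b0 a b p" "totalized b0 a b' p" for a b b' p
    using that decided_unique le_refl unfolding totalized_def undecided_below_def by blast
  show "\<exists>q\<in>P. le q p \<and> (\<exists>a\<in>A. totalized b0 a b q)" if "b \<in> B" "p \<in> P" for b p
    using decided_onto[OF that] that(1) unfolding totalized_def by blast
qed

lemma collapses_if_decided:
  assumes "Field r = A" and "Field c = B" and "B \<noteq> {}"
  shows "collapses P le c r"
proof -
  obtain b0 where "b0 \<in> B"
    using assms(3) by blast
  interpret total: decided_surjection P le A B "totalized b0"
    by (rule decided_surjection_totalized)
  show ?thesis
    using total.fsurjection_graph_name totalized_total[OF \<open>b0 \<in> B\<close>] name_of_in_names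
    by (intro collapsesI[of total.graph_name]) (simp_all add: assms(1,2))
qed

lemma decided_surjection_reindex:
  assumes "inj_on j A"
  shows "decided_surjection P le (j ` A) B (\<lambda>i. V (inv_into A j i))"
proof unfold_locales
  fix i b p q
  assume "i \<in> j ` A"
  then have "inv_into A j i \<in> A"
    by (rule inv_into_into)
  then show "V (inv_into A j i) b p" if "p \<in> P" "q \<in> P" "V (inv_into A j i) b q" "le p q"
    using decided_mono that by blast
  show "b = b'" if "p \<in> P" "V (inv_into A j i) b p" "V (inv_into A j i) b' p" for b'
    using decided_unique \<open>inv_into A j i \<in> A\<close> that by blast
next
  show "\<exists>q\<in>P. le q p \<and> (\<exists>i\<in>j ` A. V (inv_into A j i) b q)" if "b \<in> B" "p \<in> P" for b p
    using decided_onto[OF that] assms by (simp add: inv_into_f_f cong: bex_cong)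
qed

end

lemma kappa_le_if_decided:
  assumes "decided_surjection P le A (UNIV :: nat set set) V"
  shows "kappa P le \<le>o |A|"
proof -
  interpret decided_surjection P le A "UNIV :: nat set set" V
    by (rule assms)
  show ?thesis
  proof (cases "|UNIV :: nat set set| \<le>o |A|")
    case True
    with kappa_le_continuum show ?thesis
      by (rule ordLeq_transitive)
  next
    case False
    then have "|A| \<le>o |UNIV :: nat set set|"
      using ordLeq_total[OF card_of_Well_order card_of_Well_order] by blast
    then obtain j :: "'b \<Rightarrow> nat set" where "inj_on j A"
      using card_of_ordLeq[of A "UNIV :: nat set set"] by blast
    then interpret reindexed: decided_surjection P le "j ` A" "UNIV :: nat set set"
      "\<lambda>i. V (inv_into A j i)"
      by (rule decided_surjection_reindex)
    have "collapses P le |UNIV :: nat set set| |j ` A|"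
      by (rule reindexed.collapses_if_decided) (simp_all add: Field_card_of)
    then have "kappa P le \<le>o |j ` A|"
      by (rule kappa_le_if_collapses[OF card_of_Card_order])
    also have "|j ` A| \<le>o |A|"
      by (rule card_of_image)
    finally show ?thesis .
  qed
qed


section \<open>Maximal antichains and refinements in Boolean algebras\<close>

definition meeting :: "'a::boolean_algebra set \<Rightarrow> 'a \<Rightarrow> 'a set" where
  "meeting A x = {a \<in> A. inf a x \<noteq> bot}"

lemma inf_neq_bot_mono:
  fixes x :: "'a::boolean_algebra"
  assumes "inf a x \<noteq> bot" "x \<le> y"
  shows "inf a y \<noteq> bot"
  using assms by (metis bot_unique inf_mono order_refl)

lemma meeting_mono: "x \<le> y \<Longrightarrow> meeting A x \<subseteq> meeting A y"
  unfolding meeting_def using inf_neq_bot_mono by blast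

lemma antichain_unique_meeting:
  assumes "antichain A" "a \<in> A" "b \<in> A" "inf e a \<noteq> bot" "e \<le> b"
  shows "a = b"
proof -
  have "inf a b \<noteq> bot"
    using inf_neq_bot_mono[of a e b] assms(4,5) by (simp add: inf_commute)
  then show ?thesis
    using assms(1-3) unfolding antichain_def by blast
qed

lemma antichain_insert:
  assumes "antichain A" "x \<noteq> bot" "meeting A x = {}"
  shows "antichain (insert x A)"
  using assms by (auto simp: antichain_def meeting_def inf_commute)

lemma max_antichain_antichain: "max_antichain A \<Longrightarrow> antichain A"
  by (simp add: max_antichain_def)

lemma max_antichain_meeting_nonempty:
  assumes "max_antichain A" "x \<noteq> bot"
  shows "meeting A x \<noteq> {}"
proof
  assume empty: "meeting A x = {}"
  then have "antichain (insert x A)"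
    using assms antichain_insert max_antichain_antichain by blast
  then have "x \<in> A"
    using assms(1) unfolding max_antichain_def by blast
  with empty assms(2) show False
    by (auto simp: meeting_def)
qed

lemma antichain_Union_chain:
  assumes "\<And>A. A \<in> \<C> \<Longrightarrow> antichain A" and "chain\<^sub>\<subseteq> \<C>"
  shows "antichain (\<Union>\<C>)"
proof -
  have antichain_iff: "antichain A \<longleftrightarrow> bot \<notin> A \<and> pairwise (\<lambda>a b. inf a b = bot) A" for A :: "'a set"
    by (auto simp: antichain_def pairwise_def)
  show ?thesis
    using assms pairwise_chain_Union[OF _ assms(2)] unfolding antichain_iff by blast
qed

definition dense_set :: "'a::boolean_algebra set \<Rightarrow> bool" where
  "dense_set D \<longleftrightarrow> (\<forall>x. x \<noteq> bot \<longrightarrow> (\<exists>y\<in>D. y \<noteq> bot \<and> y \<le> x))"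

lemma max_antichain_within_dense_set:
  assumes "dense_set D"
  obtains R where "max_antichain R" "R \<subseteq> D"
proof -
  let ?Z = "{R. antichain R \<and> R \<subseteq> D}"
  have "\<Union>\<C> \<in> ?Z" if "subset.chain ?Z \<C>" for \<C>
    using that antichain_Union_chain[of \<C>] by (auto simp: subset_chain_def chain_subset_def)
  then obtain M where M: "antichain M" "M \<subseteq> D"
    and maximal: "\<And>X. \<lbrakk>antichain X; X \<subseteq> D; M \<subseteq> X\<rbrakk> \<Longrightarrow> X = M"
    using subset_Zorn'[of ?Z] by auto
  have "B \<subseteq> M" if B: "antichain B" "M \<subseteq> B" for B
  proof
    fix b
    assume "b \<in> B"
    with B(1) obtain y where y: "y \<in> D" "y \<noteq> bot" "y \<le> b"
      using assms unfolding dense_set_def antichain_def by metis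
    have "meeting M y \<noteq> {}"
    proof
      assume empty: "meeting M y = {}"
      then have "insert y M = M"
        using M y by (intro maximal antichain_insert) auto
      with empty y(2) show False
        by (auto simp: meeting_def)
    qed
    then obtain a where "a \<in> M" "inf y a \<noteq> bot"
      by (auto simp: meeting_def inf_commute)
    with B \<open>b \<in> B\<close> y(3) show "b \<in> M"
      using antichain_unique_meeting[OF B(1), of a b y] by blast
  qed
  with M show ?thesis
    by (intro that[of M]) (auto simp: max_antichain_def)
qed

lemma refines_trans: "\<lbrakk>refines A B; refines B C\<rbrakk> \<Longrightarrow> refines A C"
  unfolding refines_def by (meson order_trans)

lemma common_refinement_subset:
  "\<lbrakk>common_refinement R H; T \<subseteq> H\<rbrakk> \<Longrightarrow> common_refinement R T"
  unfolding common_refinement_def by blast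

lemma common_refinement_if_dense:
  assumes "dense_set {y. \<forall>A\<in>H. refines {y} A}"
  shows "\<exists>R. common_refinement R H"
proof -
  obtain R where "max_antichain R" "R \<subseteq> {y. \<forall>A\<in>H. refines {y} A}"
    using max_antichain_within_dense_set[OF assms] .
  then have "common_refinement R H"
    by (auto simp: common_refinement_def refines_def)
  then show ?thesis ..
qed

definition splits :: "'a::boolean_algebra set \<Rightarrow> 'a \<Rightarrow> bool" where
  "splits A y \<longleftrightarrow> (\<exists>a\<in>meeting A y. \<exists>b\<in>meeting A y. a \<noteq> b)"

lemma splits_if_not_refines:
  assumes A: "max_antichain A" and y: "y \<noteq> bot" "\<not> refines {y} A"
  shows "splits A y"
proof -
  obtain a where a: "a \<in> meeting A y"
    using max_antichain_meeting_nonempty[OF A y(1)] by blast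
  then have "\<not> y \<le> a"
    using y(2) by (auto simp: refines_def meeting_def)
  then have "inf y (- a) \<noteq> bot"
    by (metis double_compl inf_shunt)
  then obtain b where b: "b \<in> meeting A (inf y (- a))"
    using max_antichain_meeting_nonempty[OF A] by blast
  then have "b \<in> meeting A y"
    using meeting_mono[OF inf_le1] by blast
  moreover have "b \<noteq> a"
    using b by (auto simp: meeting_def inf.left_commute)
  ultimately show ?thesis
    using a unfolding splits_def by blast
qed

definition everywhere_splitting :: "'a::boolean_algebra set set \<Rightarrow> 'a \<Rightarrow> bool" where
  "everywhere_splitting H x \<longleftrightarrow> (\<forall>y. y \<noteq> bot \<longrightarrow> y \<le> x \<longrightarrow> (\<exists>A\<in>H. splits A y))"

lemma everywhere_splitting_mono:
  "\<lbrakk>everywhere_splitting H x; y \<le> x\<rbrakk> \<Longrightarrow> everywhere_splitting H y"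
  unfolding everywhere_splitting_def by (meson order_trans)

lemma everywhere_splitting_if_no_common_refinement:
  assumes "\<forall>A\<in>H. max_antichain A" and "\<nexists>R. common_refinement R H"
  obtains x where "x \<noteq> bot" "everywhere_splitting H x"
proof -
  obtain x where x: "x \<noteq> bot"
    and "\<And>y. \<lbrakk>y \<noteq> bot; y \<le> x\<rbrakk> \<Longrightarrow> \<exists>A\<in>H. \<not> refines {y} A"
    using assms(2) common_refinement_if_dense[of H] unfolding dense_set_def by blast
  then have "everywhere_splitting H x"
    using assms(1) splits_if_not_refines unfolding everywhere_splitting_def by blast
  with x show ?thesis
    by (rule that)
qed


section \<open>Countably closed Boolean algebras\<close>

class countably_closed_boolean_algebra = boolean_algebra +
  assumes decreasing_seq_lower_bound:
    "\<lbrakk>\<And>n::nat. y (Suc n) \<le> y n; \<And>n. y n \<noteq> bot\<rbrakk> \<Longrightarrow> \<exists>z. z \<noteq> bot \<and> (\<forall>n. z \<le> y n)"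

lemma max_antichain_refining_below:
  assumes "max_antichain A" "x \<noteq> bot"
  obtains y where "y \<noteq> bot" "y \<le> x" "refines {y} A"
proof -
  obtain a where a: "a \<in> A" "inf a x \<noteq> bot"
    using max_antichain_meeting_nonempty[OF assms] by (auto simp: meeting_def)
  then show ?thesis
    by (intro that[of "inf a x"]) (auto simp: refines_def intro: bexI[of _ a])
qed

lemma refining_below_sequence:
  fixes A :: "nat \<Rightarrow> 'a::countably_closed_boolean_algebra set"
  assumes A: "\<And>n. max_antichain (A n)" and x: "x \<noteq> bot"
  shows "\<exists>y. y \<noteq> bot \<and> y \<le> x \<and> (\<forall>n. refines {y} (A n))"
proof -
  have "\<exists>y. \<forall>n. (y n \<noteq> bot \<and> y n \<le> x) \<and> (y (Suc n) \<le> y n \<and> refines {y (Suc n)} (A n))"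
  proof (rule dependent_nat_choice)
    show "\<exists>y. y \<noteq> bot \<and> y \<le> x"
      using x by blast
    show "\<exists>z. (z \<noteq> bot \<and> z \<le> x) \<and> (z \<le> y \<and> refines {z} (A n))" if "y \<noteq> bot \<and> y \<le> x" for y n
      using max_antichain_refining_below[OF A] that by (metis order_trans)
  qed
  then obtain y where y: "\<And>n. y n \<noteq> bot" "\<And>n. y n \<le> x" "\<And>n. y (Suc n) \<le> y n"
    and ref: "\<And>n. refines {y (Suc n)} (A n)"
    by blast
  obtain z where z: "z \<noteq> bot" "\<And>n. z \<le> y n"
    using decreasing_seq_lower_bound[of y] y by blast
  have "refines {z} (A n)" for n
    using refines_trans[OF _ ref[of n], of "{z}"] z(2)[of "Suc n"] by (simp add: refines_def)
  moreover have "z \<le> x"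
    using z(2) y(2) by (rule order_trans)
  ultimately show ?thesis
    using z(1) by blast
qed

lemma countable_common_refinement:
  fixes H :: "'a::countably_closed_boolean_algebra set set"
  assumes "countable H" and max: "\<forall>A\<in>H. max_antichain A"
  shows "\<exists>R. common_refinement R H"
proof (rule common_refinement_if_dense, cases "H = {}")
  case True
  then show "dense_set {y. \<forall>A\<in>H. refines {y} A}"
    by (auto simp: dense_set_def)
next
  case False
  with \<open>countable H\<close> have H: "range (from_nat_into H) = H"
    by (simp add: range_from_nat_into)
  have "\<exists>y. y \<noteq> bot \<and> y \<le> x \<and> (\<forall>n. refines {y} (from_nat_into H n))" if "x \<noteq> bot" for x
    using max False that by (intro refining_below_sequence) (auto intro: from_nat_into)
  then have "\<exists>y. y \<noteq> bot \<and> y \<le> x \<and> (\<forall>A\<in>range (from_nat_into H). refines {y} A)" if "x \<noteq> bot" for x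
    using that by simp
  then show "dense_set {y. \<forall>A\<in>H. refines {y} A}"
    unfolding H dense_set_def by blast
qed

text \<open>A tree \<open>Y\<close> of this kind has continuum many branches, and members of a common refinement of all
  \<open>\<A> s\<close> which meet lower bounds of different branches are different.\<close>

definition splitting_tree :: "(bool list \<Rightarrow> 'a::boolean_algebra set) \<Rightarrow> (bool list \<Rightarrow> 'a) \<Rightarrow> bool" where
  "splitting_tree \<A> Y \<longleftrightarrow> (\<forall>s. Y s \<noteq> bot \<and> (\<forall>i. Y (s @ [i]) \<le> Y s) \<and>
     (\<exists>a\<in>\<A> s. \<exists>b\<in>\<A> s. a \<noteq> b \<and> Y (s @ [True]) \<le> a \<and> Y (s @ [False]) \<le> b))"

lemma splitting_tree_exists:
  assumes split: "everywhere_splitting H x" and x: "x \<noteq> bot"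
  obtains \<A> Y where "range \<A> \<subseteq> H" "splitting_tree \<A> Y" "Y [] = x"
proof -
  have "\<exists>A a b. A \<in> H \<and> a \<in> meeting A y \<and> b \<in> meeting A y \<and> a \<noteq> b" if "y \<noteq> bot" "y \<le> x" for y
    using split that unfolding everywhere_splitting_def splits_def by blast
  then obtain A a b where node: "\<And>y. \<lbrakk>y \<noteq> bot; y \<le> x\<rbrakk> \<Longrightarrow>
      A y \<in> H \<and> a y \<in> meeting (A y) y \<and> b y \<in> meeting (A y) y \<and> a y \<noteq> b y"
    by metis
  define Y where "Y = foldl (\<lambda>y i. inf (if i then a y else b y) y) x"
  have Y_Nil: "Y [] = x"
    and Y_snoc: "\<And>s i. Y (s @ [i]) = inf (if i then a (Y s) else b (Y s)) (Y s)"
    by (simp_all add: Y_def)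
  have Y: "Y s \<noteq> bot \<and> Y s \<le> x" for s
  proof (induction s rule: rev_induct)
    case Nil
    show ?case
      using x by (simp add: Y_Nil)
  next
    case (snoc i s)
    then show ?case
      using node[of "Y s"] by (auto simp: Y_snoc meeting_def intro: le_infI2)
  qed
  then have AY: "A (Y s) \<in> H" "a (Y s) \<in> A (Y s)" "b (Y s) \<in> A (Y s)" "a (Y s) \<noteq> b (Y s)" for s
    using node[of "Y s"] by (auto simp: meeting_def)
  have "splitting_tree (\<lambda>s. A (Y s)) Y"
    unfolding splitting_tree_def
  proof (intro allI conjI)
    fix s i
    show "Y s \<noteq> bot" "Y (s @ [i]) \<le> Y s"
      using Y by (auto simp: Y_snoc)
    show "\<exists>c\<in>A (Y s). \<exists>d\<in>A (Y s). c \<noteq> d \<and> Y (s @ [True]) \<le> c \<and> Y (s @ [False]) \<le> d"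
      using AY[of s] by (intro bexI[of _ "a (Y s)"] bexI[of _ "b (Y s)"]) (simp_all add: Y_snoc)
  qed
  moreover have "range (\<lambda>s. A (Y s)) \<subseteq> H"
    using AY(1) by blast
  ultimately show ?thesis
    using that Y_Nil by blast
qed

lemma refinement_meets_one_successor:
  assumes tree: "splitting_tree \<A> Y" and "antichain (\<A> s)" and R: "refines R (\<A> s)" "e \<in> R"
    and meets: "inf e (Y (s @ [i])) \<noteq> bot" "inf e (Y (s @ [j])) \<noteq> bot"
  shows "i = j"
proof -
  obtain a b where ab: "a \<in> \<A> s" "b \<in> \<A> s" "a \<noteq> b" "Y (s @ [True]) \<le> a" "Y (s @ [False]) \<le> b"
    using tree unfolding splitting_tree_def by blast
  obtain d where d: "d \<in> \<A> s" "e \<le> d"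
    using R unfolding refines_def by blast
  have eq_d: "c = d" if "c \<in> \<A> s" "Y (s @ [k]) \<le> c" "inf e (Y (s @ [k])) \<noteq> bot" for c k
    using antichain_unique_meeting[OF \<open>antichain (\<A> s)\<close> that(1) d(1) _ d(2)]
      inf_neq_bot_mono[OF that(3,2)] .
  show ?thesis
    using ab meets eq_d[of a True] eq_d[of b False] by (cases i; cases j) auto
qed

definition initial_segment :: "nat set \<Rightarrow> nat \<Rightarrow> bool list" where
  "initial_segment U n = map (\<lambda>i. i \<in> U) [0..<n]"

lemma initial_segment_0: "initial_segment U 0 = []"
  and initial_segment_Suc: "initial_segment U (Suc n) = initial_segment U n @ [n \<in> U]"
  by (simp_all add: initial_segment_def)

lemma first_difference:
  assumes "U \<noteq> V"
  obtains n where "initial_segment U n = initial_segment V n" "(n \<in> U) \<noteq> (n \<in> V)"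
proof -
  have "\<exists>n. (n \<in> U) \<noteq> (n \<in> V)"
    using assms by blast
  then obtain n where "(n \<in> U) \<noteq> (n \<in> V)" "\<And>m. m < n \<Longrightarrow> (m \<in> U) = (m \<in> V)"
    unfolding exists_least_iff[of "\<lambda>n. (n \<in> U) \<noteq> (n \<in> V)"] by blast
  then show ?thesis
    by (intro that) (simp_all add: initial_segment_def)
qed

lemma splitting_tree_branch_meets:
  fixes Y :: "bool list \<Rightarrow> 'a::countably_closed_boolean_algebra"
  assumes tree: "splitting_tree \<A> Y" and R: "max_antichain R"
  obtains e where "e \<in> R" "\<And>n. inf e (Y (initial_segment U n)) \<noteq> bot"
proof -
  obtain z where z: "z \<noteq> bot" "\<And>n. z \<le> Y (initial_segment U n)"
    using decreasing_seq_lower_bound[of "\<lambda>n. Y (initial_segment U n)"] tree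
    unfolding splitting_tree_def initial_segment_Suc by blast
  obtain e where "e \<in> R" "inf e z \<noteq> bot"
    using max_antichain_meeting_nonempty[OF R z(1)] by (auto simp: meeting_def)
  with z(2) show ?thesis
    using that[of e] inf_neq_bot_mono by blast
qed

lemma splitting_tree_continuum_meeting:
  fixes Y :: "bool list \<Rightarrow> 'a::countably_closed_boolean_algebra"
  assumes tree: "splitting_tree \<A> Y" and anti: "\<And>s. antichain (\<A> s)"
    and R: "common_refinement R (range \<A>)"
  shows "|UNIV :: nat set set| \<le>o |meeting R (Y [])|"
proof -
  have R_max: "max_antichain R" and R_refines: "\<And>s. refines R (\<A> s)"
    using R by (auto simp: common_refinement_def)
  have "\<exists>e. e \<in> R \<and> (\<forall>n. inf e (Y (initial_segment U n)) \<noteq> bot)" for U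
    using splitting_tree_branch_meets[OF tree R_max] by blast
  then obtain e where e: "\<And>U. e U \<in> R" "\<And>U n. inf (e U) (Y (initial_segment U n)) \<noteq> bot"
    by metis
  have "inj e"
  proof (rule injI, rule ccontr)
    fix U V
    assume eq: "e U = e V" and "U \<noteq> V"
    then obtain n where n: "initial_segment U n = initial_segment V n" "(n \<in> U) \<noteq> (n \<in> V)"
      using first_difference by blast
    have "(n \<in> U) = (n \<in> V)"
      using refinement_meets_one_successor[OF tree anti R_refines e(1), of U "initial_segment U n"]
        e(2)[of U "Suc n"] e(2)[of V "Suc n"] eq n(1) by (simp add: initial_segment_Suc)
    with n(2) show False
      by simp
  qed
  moreover have "range e \<subseteq> meeting R (Y [])"
    using e(1) e(2)[of _ 0] by (auto simp: meeting_def initial_segment_0)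
  ultimately show ?thesis
    using card_of_ordLeqI[of e UNIV] by blast
qed

lemma countable_subfamily_continuum_meeting:
  fixes H :: "'a::countably_closed_boolean_algebra set set"
  assumes max: "\<forall>A\<in>H. max_antichain A" and split: "everywhere_splitting H x" and x: "x \<noteq> bot"
  shows "\<exists>T\<subseteq>H. countable T \<and>
    (\<forall>R. common_refinement R T \<longrightarrow> |UNIV :: nat set set| \<le>o |meeting R x| )"
proof -
  obtain \<A> Y where tree: "range \<A> \<subseteq> H" "splitting_tree \<A> Y" "Y [] = x"
    using splitting_tree_exists[OF split x] .
  have "antichain (\<A> s)" for s
    using max tree(1) max_antichain_antichain by blast
  then have "|UNIV :: nat set set| \<le>o |meeting R x|" if "common_refinement R (range \<A>)" for R
    using splitting_tree_continuum_meeting[OF tree(2) _ that] tree(3) by simp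
  with tree(1) show ?thesis
    by (intro exI[of _ "range \<A>"]) simp
qed

lemma countable_subfamily_continuum_meeting_ball:
  fixes H :: "'a::countably_closed_boolean_algebra set set"
  assumes max: "\<forall>A\<in>H. max_antichain A" and split: "everywhere_splitting H x0"
    and X: "countable X" "\<And>x. x \<in> X \<Longrightarrow> x \<noteq> bot \<and> x \<le> x0"
  shows "\<exists>T\<subseteq>H. countable T \<and>
    (\<forall>R. common_refinement R T \<longrightarrow> (\<forall>x\<in>X. |UNIV :: nat set set| \<le>o |meeting R x| ))"
proof -
  have "\<exists>T\<subseteq>H. countable T \<and>
      (\<forall>R. common_refinement R T \<longrightarrow> |UNIV :: nat set set| \<le>o |meeting R x| )" if "x \<in> X" for x
    using X(2)[OF that] everywhere_splitting_mono[OF split]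
    by (intro countable_subfamily_continuum_meeting[OF max]) blast+
  then obtain T where T: "\<And>x. x \<in> X \<Longrightarrow> T x \<subseteq> H \<and> countable (T x)"
    and continuum: "\<And>x R. \<lbrakk>x \<in> X; common_refinement R (T x)\<rbrakk> \<Longrightarrow>
      |UNIV :: nat set set| \<le>o |meeting R x|"
    by metis
  have "|UNIV :: nat set set| \<le>o |meeting R x|"
    if R: "common_refinement R (\<Union>x\<in>X. T x)" and x: "x \<in> X" for R x
    by (rule continuum[OF x common_refinement_subset[OF R]]) (use x in blast)
  moreover have "(\<Union>x\<in>X. T x) \<subseteq> H" "countable (\<Union>x\<in>X. T x)"
    using X(1) T by (auto intro: countable_UN)
  ultimately show ?thesis
    by blast
qed


section \<open>Critical families of antichains\<close>

definition critical_family :: "'a::boolean_algebra set set \<Rightarrow> bool" where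
  "critical_family H \<longleftrightarrow> (\<forall>A\<in>H. max_antichain A) \<and> (\<nexists>R. common_refinement R H) \<and>
     (\<forall>T\<subseteq>H. |T| <o |H| \<longrightarrow> (\<exists>R. common_refinement R T))"

lemma common_refinement_trans:
  assumes "common_refinement S \<Q>" and "\<And>A. A \<in> H \<Longrightarrow> \<exists>Q\<in>\<Q>. refines Q A"
  shows "common_refinement S H"
  using assms refines_trans unfolding common_refinement_def by blast

lemma common_refinement_insert:
  fixes A :: "'a::countably_closed_boolean_algebra set"
  assumes R: "common_refinement R H" and A: "max_antichain A"
  shows "\<exists>S. common_refinement S (insert A H)"
proof -
  obtain S where "common_refinement S {R, A}"
    using countable_common_refinement[of "{R, A}"] R A by (auto simp: common_refinement_def)
  then have "common_refinement S (insert A H)"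
    by (rule common_refinement_trans)
      (use R in \<open>auto simp: common_refinement_def refines_def[of A]\<close>)
  then show ?thesis ..
qed

lemma critical_family_initial_segments:
  fixes H :: "'a::countably_closed_boolean_algebra set set"
  assumes H: "critical_family H" and C: "C \<in> H"
  shows "\<exists>R. common_refinement R (under |H| C)"
proof -
  have C_Field: "C \<in> Field |H|"
    using C by (simp only: Field_card_of)
  have "|underS |H| C| <o |H|"
    by (rule card_of_underS[OF card_of_Card_order C_Field])
  moreover have "underS |H| C \<subseteq> H"
    by (auto dest: underS_Field simp: Field_card_of)
  ultimately obtain R where "common_refinement R (underS |H| C)"
    using H unfolding critical_family_def by blast
  then have "\<exists>S. common_refinement S (insert C (underS |H| C))"
    using H C by (intro common_refinement_insert) (auto simp: critical_family_def)
  moreover have "under |H| C = insert C (underS |H| C)"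
    using Refl_under_underS[OF wo_rel.REFL[OF wo_rel.intro[OF card_of_Well_order]] C_Field] by simp
  ultimately show ?thesis
    by simp
qed

text \<open>If \<open>T\<close> were cofinal in \<open>H\<close>, a common refinement of the countably many \<open>\<R> C\<close> with \<open>C \<in> T\<close> would
  refine all of \<open>H\<close>.\<close>

lemma critical_family_countable_bounded:
  fixes H :: "'a::countably_closed_boolean_algebra set set"
  assumes H: "critical_family H" and R: "\<And>C. C \<in> H \<Longrightarrow> common_refinement (\<R> C) (under |H| C)"
    and T: "T \<subseteq> H" "countable T"
  shows "\<exists>C\<in>H. T \<subseteq> under |H| C"
proof (rule ccontr)
  assume unbounded: "\<not> (\<exists>C\<in>H. T \<subseteq> under |H| C)"
  have cofinal: "\<exists>A\<in>T. C \<in> under |H| A" if C: "C \<in> H" for C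
  proof -
    obtain A where A: "A \<in> T" "(A, C) \<notin> |H|"
      using unbounded C unfolding under_def by blast
    have "(A, C) \<in> |H| \<or> (C, A) \<in> |H|"
      using wo_rel.TOTALS[OF wo_rel.intro[OF card_of_Well_order], of H] A(1) T(1) C
      unfolding Field_card_of by blast
    with A show ?thesis
      unfolding under_def by blast
  qed
  have "\<forall>A\<in>\<R> ` T. max_antichain A"
    using R T(1) unfolding common_refinement_def by blast
  then obtain S where "common_refinement S (\<R> ` T)"
    using countable_common_refinement[OF countable_image[OF T(2)]] by blast
  then have "common_refinement S H"
  proof (rule common_refinement_trans)
    fix C
    assume "C \<in> H"
    then obtain A where A: "A \<in> T" "C \<in> under |H| A"
      using cofinal by blast
    then have "refines (\<R> A) C"
      using R[of A] T(1) by (auto simp: common_refinement_def)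
    with A(1) show "\<exists>Q\<in>\<R> ` T. refines Q C"
      by blast
  qed
  with H show False
    unfolding critical_family_def by blast
qed

lemma countably_directed_refinements:
  fixes H :: "'a::countably_closed_boolean_algebra set set"
  assumes H: "critical_family H"
  obtains \<R> where "\<And>C. C \<in> H \<Longrightarrow> max_antichain (\<R> C)"
    and "\<And>T. \<lbrakk>T \<subseteq> H; countable T\<rbrakk> \<Longrightarrow> \<exists>C\<in>H. common_refinement (\<R> C) T"
proof -
  obtain \<R> where R: "\<And>C. C \<in> H \<Longrightarrow> common_refinement (\<R> C) (under |H| C)"
    using critical_family_initial_segments[OF H] by metis
  have max: "max_antichain (\<R> C)" if "C \<in> H" for C
    using R[OF that] by (simp add: common_refinement_def)
  have directed: "\<exists>C\<in>H. common_refinement (\<R> C) T" if "T \<subseteq> H" "countable T" for T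
    using critical_family_countable_bounded[OF H R that] common_refinement_subset[OF R] by blast
  show ?thesis
    by (rule that[OF max directed])
qed


section \<open>Colourings\<close>

lemma choice_avoiding_predecessors:
  assumes S: "\<And>k. k \<in> K \<Longrightarrow> |K| \<le>o |S k|"
  obtains h where "\<And>k. k \<in> K \<Longrightarrow> h k \<in> S k - h ` underS |K| k"
proof -
  let ?r = "|K|"
  have wf: "wf (?r - Id)"
    using card_of_Well_order[of K] by (simp add: well_order_on_def)
  define new where "new h k y \<longleftrightarrow> (k \<in> K \<longrightarrow> y \<in> S k - h ` underS ?r k)" for h k y
  have "\<exists>h. \<forall>k. new h k (h k)"
  proof (rule dependent_wf_choice[OF wf])
    fix h g :: "'a \<Rightarrow> 'b" and k y
    assume "\<And>z. (z, k) \<in> ?r - Id \<Longrightarrow> h z = g z"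
    then have "h ` underS ?r k = g ` underS ?r k"
      by (intro image_cong) (auto simp: underS_def)
    then show "new h k y = new g k y"
      by (simp add: new_def)
  next
    fix k and h :: "'a \<Rightarrow> 'b"
    have "\<not> S k \<subseteq> h ` underS ?r k" if k: "k \<in> K"
    proof -
      have "|h ` underS ?r k| \<le>o |underS ?r k|"
        by (rule card_of_image)
      also have "|underS ?r k| <o ?r"
        by (rule card_of_underS[OF card_of_Card_order]) (simp only: Field_card_of k)
      also have "?r \<le>o |S k|"
        by (rule S[OF k])
      finally show ?thesis
        using card_of_mono1 not_ordLess_ordLeq by blast
    qed
    then show "\<exists>y. new h k y"
      unfolding new_def by blast
  qed
  then show ?thesis
    using that unfolding new_def by blast
qed

lemma inj_on_if_avoiding_predecessors:
  assumes avoid: "\<And>k. k \<in> K \<Longrightarrow> h k \<notin> h ` underS |K| k"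
  shows "inj_on h K"
proof (rule inj_onI, rule ccontr)
  fix k l
  assume kl: "k \<in> K" "l \<in> K" "h k = h l" "k \<noteq> l"
  have "(k, l) \<in> |K| \<or> (l, k) \<in> |K|"
    using wo_rel.TOTALS[OF wo_rel.intro[OF card_of_Well_order], of K] kl(1,2)
    unfolding Field_card_of by blast
  with kl(4) have "k \<in> underS |K| l \<or> l \<in> underS |K| k"
    unfolding underS_def by blast
  with avoid kl show False
    by (metis image_eqI)
qed

lemma surjective_colouring:
  fixes S :: "'j \<Rightarrow> 'a set"
  assumes inf: "infinite (UNIV :: 'c set)" and J: "|J| \<le>o |UNIV :: 'c set|"
    and S: "\<And>j. j \<in> J \<Longrightarrow> |UNIV :: 'c set| \<le>o |S j|"
  shows "\<exists>g :: 'a \<Rightarrow> 'c. \<forall>j\<in>J. g ` S j = UNIV"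
proof -
  let ?K = "J \<times> (UNIV :: 'c set)"
  have "|?K| \<le>o |UNIV :: 'c set|"
    using inf J card_of_mono1[OF subset_UNIV]
    by (intro card_of_Times_ordLeq_infinite_Field)
      (simp_all add: Field_card_of card_of_card_order_on)
  then have "|?K| \<le>o |S (fst k)|" if "k \<in> ?K" for k
    using that by (intro ordLeq_transitive[OF _ S]) auto
  then obtain h where avoid: "\<And>k. k \<in> ?K \<Longrightarrow> h k \<in> S (fst k) - h ` underS |?K| k"
    using choice_avoiding_predecessors[of ?K "\<lambda>k. S (fst k)"] by blast
  then have "inj_on h ?K"
    by (intro inj_on_if_avoiding_predecessors) blast
  have "c \<in> (snd \<circ> inv_into ?K h) ` S j" if "j \<in> J" for j c
    using avoid[of "(j, c)"] that
    by (intro image_eqI[of _ _ "h (j, c)"]) (simp_all add: inv_into_f_f[OF \<open>inj_on h ?K\<close>])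
  then show ?thesis
    by (intro exI[of _ "snd \<circ> inv_into ?K h"]) blast
qed

lemma colouring_surjective_on_meeting:
  fixes R :: "'a::boolean_algebra set"
  assumes "infinite (UNIV :: 'c set)" and "|UNIV :: 'a set| \<le>o |UNIV :: 'c set|"
  shows "\<exists>g :: 'a \<Rightarrow> 'c. \<forall>x. |UNIV :: 'c set| \<le>o |meeting R x| \<longrightarrow> g ` meeting R x = UNIV"
proof -
  let ?J = "{x. |UNIV :: 'c set| \<le>o |meeting R x|}"
  have "|?J| \<le>o |UNIV :: 'c set|"
    using card_of_mono1[OF subset_UNIV] assms(2) by (rule ordLeq_transitive)
  then have "\<exists>g :: 'a \<Rightarrow> 'c. \<forall>x\<in>?J. g ` meeting R x = UNIV"
    by (rule surjective_colouring[OF assms(1)]) simp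
  then show ?thesis
    by simp
qed

lemma critical_family_colouring:
  fixes H :: "'a::countably_closed_boolean_algebra set set"
  assumes H: "critical_family H" and small: "|UNIV :: 'a set| \<le>o |UNIV :: nat set set|"
  obtains x0 and \<R> :: "'a set \<Rightarrow> 'a set" and g :: "'a set \<Rightarrow> 'a \<Rightarrow> nat set"
  where "x0 \<noteq> bot" and "\<And>C. C \<in> H \<Longrightarrow> max_antichain (\<R> C)"
    and "\<And>X. \<lbrakk>countable X; \<And>x. x \<in> X \<Longrightarrow> x \<noteq> bot \<and> x \<le> x0\<rbrakk> \<Longrightarrow>
      \<exists>C\<in>H. \<forall>x\<in>X. g C ` meeting (\<R> C) x = UNIV"
proof -
  have max: "\<forall>A\<in>H. max_antichain A"
    using H by (simp add: critical_family_def)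
  obtain x0 where x0: "x0 \<noteq> bot" "everywhere_splitting H x0"
    using everywhere_splitting_if_no_common_refinement[OF max] H
    unfolding critical_family_def by blast
  obtain \<R> where R: "\<And>C. C \<in> H \<Longrightarrow> max_antichain (\<R> C)"
    and directed: "\<And>T. \<lbrakk>T \<subseteq> H; countable T\<rbrakk> \<Longrightarrow> \<exists>C\<in>H. common_refinement (\<R> C) T"
    by (rule countably_directed_refinements[OF H]) blast
  have "infinite (UNIV :: nat set set)"
    by (simp add: Finite_Set.finite_set)
  then have "\<exists>g :: 'a \<Rightarrow> nat set. \<forall>x. |UNIV :: nat set set| \<le>o |meeting (\<R> C) x| \<longrightarrow>
      g ` meeting (\<R> C) x = UNIV" for C
    by (rule colouring_surjective_on_meeting[OF _ small])
  then obtain g :: "'a set \<Rightarrow> 'a \<Rightarrow> nat set" where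
    g: "\<And>C x. |UNIV :: nat set set| \<le>o |meeting (\<R> C) x| \<Longrightarrow> g C ` meeting (\<R> C) x = UNIV"
    by metis
  have "\<exists>C\<in>H. \<forall>x\<in>X. g C ` meeting (\<R> C) x = UNIV"
    if X: "countable X" "\<And>x. x \<in> X \<Longrightarrow> x \<noteq> bot \<and> x \<le> x0" for X
  proof -
    obtain T where T: "T \<subseteq> H" "countable T"
      and continuum: "\<forall>R. common_refinement R T \<longrightarrow> (\<forall>x\<in>X. |UNIV :: nat set set| \<le>o |meeting R x| )"
      using countable_subfamily_continuum_meeting_ball[OF max x0(2) X] by blast
    obtain C where "C \<in> H" "common_refinement (\<R> C) T"
      using directed[OF T] by blast
    with continuum g show ?thesis
      by blast
  qed
  with x0(1) R show ?thesis
    by (rule that)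
qed


section \<open>Colourings of infinite sets of natural numbers\<close>

lemma pseudointersection_exists:
  fixes Y :: "nat \<Rightarrow> nat set"
  assumes infinite: "\<And>n. infinite (Y n)" and almost_decreasing: "\<And>m n. m \<le> n \<Longrightarrow> finite (Y n - Y m)"
  obtains Z where "infinite Z" "\<And>n. finite (Z - Y n)"
proof -
  have inf: "infinite (\<Inter>i\<le>n. Y i)" for n
  proof
    assume "finite (\<Inter>i\<le>n. Y i)"
    moreover have "finite (\<Union>i\<le>n. Y n - Y i)"
      using almost_decreasing by (intro finite_UN_I) auto
    moreover have "Y n \<subseteq> (\<Inter>i\<le>n. Y i) \<union> (\<Union>i\<le>n. Y n - Y i)"
      by blast
    ultimately show False
      using infinite[of n] by (meson finite_UnI finite_subset)
  qed
  have "\<exists>k. \<forall>n. k n \<in> (\<Inter>i\<le>n. Y i) \<and> k n < k (Suc n)"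
  proof (rule dependent_nat_choice)
    show "\<exists>k. k \<in> (\<Inter>i\<le>0. Y i)"
      using infinite_imp_nonempty[OF inf[of 0]] by blast
    show "\<exists>k'. k' \<in> (\<Inter>i\<le>Suc n. Y i) \<and> k < k'" for k n
      using inf[of "Suc n"] by (metis infinite_nat_iff_unbounded)
  qed
  then obtain k where k: "\<And>n. k n \<in> (\<Inter>i\<le>n. Y i)" and "\<And>n. k n < k (Suc n)"
    by blast
  then have "inj k"
    by (intro strict_mono_imp_inj_on) (simp add: strict_mono_Suc_iff)
  then have "infinite (range k)"
    by (rule range_inj_infinite)
  moreover have "finite (range k - Y n)" for n
  proof -
    have "k m \<in> Y n" if "\<not> m < n" for m
      using k[of m] that by simp
    then have "range k - Y n \<subseteq> k ` {..<n}"
      by blast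
    then show ?thesis
      by (rule finite_subset) simp
  qed
  ultimately show ?thesis
    by (rule that)
qed

lemma abs_pfin_le_iff: "abs_pfin A \<le> abs_pfin B \<longleftrightarrow> finite (A - B)"
  by (rule less_eq_pfin.abs_eq)

lemma abs_pfin_mono: "A \<subseteq> B \<Longrightarrow> abs_pfin A \<le> abs_pfin B"
  unfolding abs_pfin_le_iff by (metis Diff_eq_empty_iff finite.emptyI)

lemma abs_pfin_eq_bot_iff: "abs_pfin A = bot \<longleftrightarrow> finite A"
  by (simp add: bot_pfin_def pfin.abs_eq_iff)

lemma abs_rep_pfin: "abs_pfin (rep_pfin x) = x"
  by (rule Quotient3_abs_rep[OF Quotient3_pfin])

instance pfin :: countably_closed_boolean_algebra
proof
  fix y :: "nat \<Rightarrow> pfin"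
  assume dec: "\<And>n. y (Suc n) \<le> y n" and nonzero: "\<And>n. y n \<noteq> bot"
  define Y where "Y n = rep_pfin (y n)" for n
  have y: "y n = abs_pfin (Y n)" for n
    by (simp add: Y_def abs_rep_pfin)
  have "infinite (Y n)" for n
    using nonzero[of n] by (simp add: y abs_pfin_eq_bot_iff)
  moreover have "finite (Y n - Y m)" if "m \<le> n" for m n
    using lift_Suc_antimono_le[of y, OF dec that] by (simp add: y abs_pfin_le_iff)
  ultimately obtain Z where "infinite Z" "\<And>n. finite (Z - Y n)"
    using pseudointersection_exists[of Y] by blast
  then show "\<exists>z. z \<noteq> bot \<and> (\<forall>n. z \<le> y n)"
    by (intro exI[of _ "abs_pfin Z"]) (simp add: y abs_pfin_eq_bot_iff abs_pfin_le_iff)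
qed

lemma card_pfin_le_continuum: "|UNIV :: pfin set| \<le>o |UNIV :: nat set set|"
  by (rule card_of_ordLeqI[of rep_pfin]) (auto intro: inj_on_inverseI abs_rep_pfin)

lemma cardinal_h_critical_family:
  obtains H :: "pfin set set" where "critical_family H" "\<hh> = |H|"
proof -
  obtain H :: "pfin set set" where H: "\<forall>A\<in>H. max_antichain A" "\<nexists>R. common_refinement R H"
    and h: "\<hh> = |H|"
    using cardinal_h_welldefined(1) by blast
  have "\<exists>R. common_refinement R T" if "T \<subseteq> H" "|T| <o |H|" for T
    using cardinal_h_welldefined(2)[of T] H(1) that h not_ordLess_ordLeq[of "|T|" "|H|"] by auto
  with H have "critical_family H"
    by (simp add: critical_family_def)
  then show ?thesis
    using h by (rule that)
qed

text \<open>Each index \<open>i\<close> is a partial colouring of the infinite sets: \<open>\<Phi> i N z\<close> says that \<open>N\<close> has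
  colour \<open>z\<close>.\<close>

locale colouring_system =
  fixes I :: "'i set" and \<Phi> :: "'i \<Rightarrow> nat set \<Rightarrow> 'c \<Rightarrow> bool"
  assumes colour_hereditary: "\<lbrakk>i \<in> I; \<Phi> i N z; M \<subseteq> N\<rbrakk> \<Longrightarrow> \<Phi> i M z"
    and colour_unique: "\<lbrakk>i \<in> I; infinite N; \<Phi> i N z; \<Phi> i N z'\<rbrakk> \<Longrightarrow> z = z'"
    and all_colours_below: "\<lbrakk>countable \<N>; \<And>N. N \<in> \<N> \<Longrightarrow> infinite N\<rbrakk> \<Longrightarrow>
      \<exists>i\<in>I. \<forall>N\<in>\<N>. \<forall>z. \<exists>M\<subseteq>N. infinite M \<and> \<Phi> i M z"

lemma infinite_subset_image_below:
  assumes "inf e (abs_pfin (f ` N)) \<noteq> bot"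
  obtains M where "M \<subseteq> N" "infinite M" "abs_pfin (f ` M) \<le> e"
proof -
  define M where "M = {n \<in> N. f n \<in> rep_pfin e}"
  have "inf e (abs_pfin (f ` N)) = abs_pfin (rep_pfin e \<inter> f ` N)"
    by (metis abs_rep_pfin inf_pfin.abs_eq)
  also have "rep_pfin e \<inter> f ` N = f ` M"
    by (auto simp: M_def)
  finally have "infinite (f ` M)"
    using assms by (simp add: abs_pfin_eq_bot_iff)
  then have "infinite M"
    by blast
  moreover have "abs_pfin (f ` M) \<le> e"
    using abs_pfin_mono[of "f ` M" "rep_pfin e"] by (auto simp: M_def abs_rep_pfin)
  ultimately show ?thesis
    by (intro that[of M]) (auto simp: M_def)
qed

lemma image_below_exists:
  assumes "x \<noteq> bot"
  obtains f :: "nat \<Rightarrow> nat" where "inj f" "\<And>N. abs_pfin (f ` N) \<le> x"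
proof -
  define X where "X = rep_pfin x"
  have x: "x = abs_pfin X"
    by (simp add: X_def abs_rep_pfin)
  with assms have X: "infinite X"
    by (simp add: abs_pfin_eq_bot_iff)
  then have "inj (enumerate X)"
    by (simp add: strict_mono_enumerate strict_mono_imp_inj_on)
  moreover have "abs_pfin (enumerate X ` N) \<le> x" for N
    unfolding x using enumerate_in_set[OF X] by (intro abs_pfin_mono) blast
  ultimately show ?thesis
    by (rule that)
qed

lemma colouring_system_of_antichains:
  fixes g :: "'i \<Rightarrow> pfin \<Rightarrow> 'c"
  assumes f: "inj f" and anti: "\<And>i. i \<in> I \<Longrightarrow> antichain (\<R> i)"
    and onto: "\<And>\<N>. \<lbrakk>countable \<N>; \<And>N. N \<in> \<N> \<Longrightarrow> infinite N\<rbrakk> \<Longrightarrow>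
      \<exists>i\<in>I. \<forall>N\<in>\<N>. g i ` meeting (\<R> i) (abs_pfin (f ` N)) = UNIV"
  shows "colouring_system I (\<lambda>i N z. \<exists>e\<in>\<R> i. g i e = z \<and> abs_pfin (f ` N) \<le> e)"
proof unfold_locales
  fix i N z
  assume i: "i \<in> I" and z: "\<exists>e\<in>\<R> i. g i e = z \<and> abs_pfin (f ` N) \<le> e"
  show "\<exists>e\<in>\<R> i. g i e = z \<and> abs_pfin (f ` M) \<le> e" if "M \<subseteq> N" for M
    using z abs_pfin_mono[OF image_mono[OF that], of f] by (meson order_trans)
  show "z = z'" if N: "infinite N" and z': "\<exists>e\<in>\<R> i. g i e = z' \<and> abs_pfin (f ` N) \<le> e" for z'
  proof -
    obtain e e' where e: "e \<in> \<R> i" "g i e = z" "abs_pfin (f ` N) \<le> e"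
      and e': "e' \<in> \<R> i" "g i e' = z'" "abs_pfin (f ` N) \<le> e'"
      using z z' by blast
    have "abs_pfin (f ` N) \<noteq> bot"
      using N f by (simp add: abs_pfin_eq_bot_iff finite_image_iff inj_on_subset)
    with e(3) have "inf (abs_pfin (f ` N)) e \<noteq> bot"
      by (simp add: inf_absorb1)
    then have "e = e'"
      using antichain_unique_meeting[OF anti[OF i] e(1) e'(1)] e'(3) by blast
    with e(2) e'(2) show ?thesis
      by simp
  qed
next
  fix \<N> :: "nat set set"
  assume "countable \<N>" and "\<And>N. N \<in> \<N> \<Longrightarrow> infinite N"
  then obtain i where i: "i \<in> I"
    and onto_i: "\<And>N. N \<in> \<N> \<Longrightarrow> g i ` meeting (\<R> i) (abs_pfin (f ` N)) = UNIV"
    using onto[of \<N>] by blast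
  have "\<exists>M\<subseteq>N. infinite M \<and> (\<exists>e\<in>\<R> i. g i e = z \<and> abs_pfin (f ` M) \<le> e)" if N: "N \<in> \<N>" for N z
  proof -
    have "z \<in> g i ` meeting (\<R> i) (abs_pfin (f ` N))"
      using onto_i[OF N] by simp
    then obtain e where "e \<in> \<R> i" "g i e = z" "inf e (abs_pfin (f ` N)) \<noteq> bot"
      by (auto simp: meeting_def)
    then show ?thesis
      using infinite_subset_image_below by metis
  qed
  with i show "\<exists>i\<in>I. \<forall>N\<in>\<N>. \<forall>z. \<exists>M\<subseteq>N. infinite M \<and> (\<exists>e\<in>\<R> i. g i e = z \<and> abs_pfin (f ` M) \<le> e)"
    by blast
qed

lemma cardinal_h_colouring_system:
  obtains H :: "pfin set set" and \<Phi> :: "pfin set \<Rightarrow> nat set \<Rightarrow> nat set \<Rightarrow> bool"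
  where "colouring_system H \<Phi>" "\<hh> = |H|"
proof -
  obtain H :: "pfin set set" where H: "critical_family H" and h: "\<hh> = |H|"
    using cardinal_h_critical_family .
  obtain x0 and \<R> :: "pfin set \<Rightarrow> pfin set" and g :: "pfin set \<Rightarrow> pfin \<Rightarrow> nat set"
    where x0: "x0 \<noteq> bot" and R: "\<And>C. C \<in> H \<Longrightarrow> max_antichain (\<R> C)"
      and g: "\<And>X. \<lbrakk>countable X; \<And>x. x \<in> X \<Longrightarrow> x \<noteq> bot \<and> x \<le> x0\<rbrakk> \<Longrightarrow>
        \<exists>C\<in>H. \<forall>x\<in>X. g C ` meeting (\<R> C) x = UNIV"
    by (rule critical_family_colouring[OF H card_pfin_le_continuum]) blast
  obtain f :: "nat \<Rightarrow> nat" where f: "inj f" and below: "\<And>N. abs_pfin (f ` N) \<le> x0"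
    by (rule image_below_exists[OF x0]) blast
  have "colouring_system H (\<lambda>C N z. \<exists>e\<in>\<R> C. g C e = z \<and> abs_pfin (f ` N) \<le> e)"
  proof (rule colouring_system_of_antichains[OF f])
    show "antichain (\<R> C)" if "C \<in> H" for C
      using R[OF that] by (rule max_antichain_antichain)
    fix \<N> :: "nat set set"
    assume "countable \<N>" and "\<And>N. N \<in> \<N> \<Longrightarrow> infinite N"
    then have "\<exists>C\<in>H. \<forall>x\<in>(\<lambda>N. abs_pfin (f ` N)) ` \<N>. g C ` meeting (\<R> C) x = UNIV"
      using below f
      by (intro g) (auto simp: abs_pfin_eq_bot_iff finite_image_iff inj_on_subset)
    then show "\<exists>C\<in>H. \<forall>N\<in>\<N>. g C ` meeting (\<R> C) (abs_pfin (f ` N)) = UNIV"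
      by blast
  qed
  then show ?thesis
    using h by (rule that)
qed


section \<open>Thinning out trees\<close>

definition split_nodes :: "nat list set \<Rightarrow> nat list set" where
  "split_nodes p = {s \<in> p. infinite (Succ p s)}"

definition thin :: "nat list set \<Rightarrow> (nat list \<Rightarrow> nat set) \<Rightarrow> nat list set" where
  "thin p B = {t \<in> p. \<forall>s\<in>split_nodes p. \<forall>n. prefix (s @ [n]) t \<longrightarrow> n \<in> B s}"

definition thinnable :: "nat list set set \<Rightarrow> bool" where
  "thinnable P \<longleftrightarrow> (\<forall>p\<in>P. split_nodes p \<noteq> {} \<and>
     (\<forall>B. (\<forall>s\<in>split_nodes p. infinite (Succ p s \<inter> B s)) \<longrightarrow> thin p B \<in> P))"

lemma Succ_mono: "p \<subseteq> q \<Longrightarrow> Succ p s \<subseteq> Succ q s"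
  by (auto simp: Succ_def)

lemma split_nodes_mono: "p \<subseteq> q \<Longrightarrow> split_nodes p \<subseteq> split_nodes q"
  by (auto simp: split_nodes_def dest: finite_subset[OF Succ_mono])

lemma thin_subset: "thin p B \<subseteq> p"
  by (auto simp: thin_def)

lemma Succ_thin:
  assumes "s \<in> thin p B" "s \<in> split_nodes p"
  shows "Succ (thin p B) s = Succ p s \<inter> B s"
  using assms by (auto simp: Succ_def thin_def)

lemma split_nodes_thin:
  assumes "\<forall>s\<in>split_nodes p. infinite (Succ p s \<inter> B s)"
  shows "split_nodes (thin p B) = thin p B \<inter> split_nodes p"
proof
  show "split_nodes (thin p B) \<subseteq> thin p B \<inter> split_nodes p"
    using split_nodes_mono[OF thin_subset] by (auto simp: split_nodes_def)
  show "thin p B \<inter> split_nodes p \<subseteq> split_nodes (thin p B)"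
    using assms by (auto simp: split_nodes_def[of "thin p B"] Succ_thin)
qed

lemma tree_prefix_closed: "\<lbrakk>tree p; t \<in> p; prefix s t\<rbrakk> \<Longrightarrow> s \<in> p"
  by (auto simp: tree_def)

lemma Nil_in_tree: "tree p \<Longrightarrow> [] \<in> p"
  by (auto simp: tree_def)

lemma tree_thin:
  assumes "tree p"
  shows "tree (thin p B)"
proof -
  have "[] \<in> thin p B"
    using Nil_in_tree[OF assms] by (simp add: thin_def)
  moreover have "s \<in> thin p B" if "t \<in> thin p B" "prefix s t" for s t
    using that tree_prefix_closed[OF assms] prefix_order.trans unfolding thin_def by blast
  ultimately show ?thesis
    unfolding tree_def by blast
qed

lemma Succ_below_comparable_node:
  assumes "comparable_node p t" "prefix (s @ [n]) t"
  shows "Succ p s \<subseteq> {n}"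
proof
  fix m
  assume "m \<in> Succ p s"
  then have "prefix t (s @ [m]) \<or> prefix (s @ [m]) t"
    using assms(1) unfolding comparable_node_def Succ_def by blast
  then have "prefix (s @ [n]) (s @ [m]) \<or> prefix (s @ [m]) (s @ [n])"
    using assms(2) by (metis prefix_order.trans prefix_same_cases)
  then show "m \<in> {n}"
    by auto
qed

lemma not_split_node_below_comparable_node:
  assumes "comparable_node p t" "prefix (s @ [n]) t"
  shows "s \<notin> split_nodes p"
  using Succ_below_comparable_node[OF assms] finite_subset by (auto simp: split_nodes_def)

lemma comparable_node_prefix_split_node:
  assumes s: "comparable_node p s" and t: "t \<in> split_nodes p"
  shows "prefix s t"
proof (rule ccontr)
  assume "\<not> prefix s t"
  moreover have "prefix s t \<or> prefix t s"
    using s t by (simp add: comparable_node_def split_nodes_def)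
  ultimately have "strict_prefix t s"
    by (auto simp: strict_prefix_def)
  then obtain n where "prefix (t @ [n]) s"
    by (auto elim!: strict_prefixE' simp: prefix_def)
  with s t show False
    using not_split_node_below_comparable_node by blast
qed

lemma stem_exists:
  assumes "tree p" "t \<in> split_nodes p"
  shows "\<exists>s. is_stem p s"
proof -
  have "comparable_node p []"
    using Nil_in_tree[OF assms(1)] by (simp add: comparable_node_def)
  moreover have "\<forall>s. comparable_node p s \<longrightarrow> length s \<le> length t"
    using comparable_node_prefix_split_node[OF _ assms(2)] prefix_length_le by blast
  ultimately have "\<exists>s. comparable_node p s \<and> (\<forall>u. comparable_node p u \<longrightarrow> length u \<le> length s)"
    by (intro ex_has_greatest_nat[where b = "Suc (length t)"]) (auto simp: less_Suc_eq_le)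
  then obtain s where s: "comparable_node p s"
    and longest: "\<And>u. comparable_node p u \<Longrightarrow> length u \<le> length s"
    by blast
  have "u = s" if "comparable_node p u" "prefix s u" for u
    using longest[OF that(1)] that(2) by (auto simp: prefix_def)
  with s show ?thesis
    unfolding is_stem_def by blast
qed

lemma comparable_node_prefix_stem: "\<lbrakk>is_stem p s; comparable_node p t\<rbrakk> \<Longrightarrow> prefix t s"
  unfolding is_stem_def comparable_node_def by blast

lemma laver_iff:
  "p \<in> laver \<longleftrightarrow>
    tree p \<and> (\<exists>s. comparable_node p s \<and> (\<forall>t\<in>p. prefix s t \<longrightarrow> t \<in> split_nodes p))"
proof
  assume "p \<in> laver"
  then show "tree p \<and> (\<exists>s. comparable_node p s \<and> (\<forall>t\<in>p. prefix s t \<longrightarrow> t \<in> split_nodes p))"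
    by (auto simp: laver_def is_stem_def split_nodes_def)
next
  assume "tree p \<and> (\<exists>s. comparable_node p s \<and> (\<forall>t\<in>p. prefix s t \<longrightarrow> t \<in> split_nodes p))"
  then obtain s where p: "tree p" and s: "comparable_node p s"
    and split: "\<And>t. \<lbrakk>t \<in> p; prefix s t\<rbrakk> \<Longrightarrow> t \<in> split_nodes p"
    by blast
  have "s \<in> split_nodes p"
    using s split by (simp add: comparable_node_def)
  then obtain r where r: "is_stem p r"
    using stem_exists[OF p] by blast
  then have "prefix s r"
    using s by (rule comparable_node_prefix_stem)
  then have "\<forall>t\<in>p. prefix r t \<longrightarrow> infinite (Succ p t)"
    using split prefix_order.trans unfolding split_nodes_def by blast
  with p r show "p \<in> laver"
    unfolding laver_def by blast
qed

lemma miller_iff: "p \<in> miller \<longleftrightarrow> tree p \<and> (\<forall>s\<in>p. \<exists>t\<in>split_nodes p. prefix s t)"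
proof
  assume "p \<in> miller"
  then show "tree p \<and> (\<forall>s\<in>p. \<exists>t\<in>split_nodes p. prefix s t)"
    unfolding miller_def split_nodes_def by blast
next
  assume p: "tree p \<and> (\<forall>s\<in>p. \<exists>t\<in>split_nodes p. prefix s t)"
  then have "\<exists>s. is_stem p s"
    using stem_exists Nil_in_tree by blast
  with p show "p \<in> miller"
    unfolding miller_def split_nodes_def by blast
qed

lemma comparable_node_in_thin: "comparable_node p s \<Longrightarrow> s \<in> thin p B"
  unfolding thin_def using not_split_node_below_comparable_node
  by (auto simp: comparable_node_def)

lemma thinnable_laver: "thinnable laver"
  unfolding thinnable_def
proof (intro ballI conjI allI impI)
  fix p
  assume "p \<in> laver"
  then obtain s where p: "tree p" and s: "comparable_node p s"
    and split: "\<And>t. \<lbrakk>t \<in> p; prefix s t\<rbrakk> \<Longrightarrow> t \<in> split_nodes p"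
    unfolding laver_iff by blast
  show "split_nodes p \<noteq> {}"
    using s split[of s] by (auto simp: comparable_node_def)
  fix B
  assume B: "\<forall>s\<in>split_nodes p. infinite (Succ p s \<inter> B s)"
  have "comparable_node (thin p B) s"
    using s comparable_node_in_thin[OF s] thin_subset unfolding comparable_node_def by blast
  moreover have "t \<in> split_nodes (thin p B)" if "t \<in> thin p B" "prefix s t" for t
    using split that thin_subset unfolding split_nodes_thin[OF B] by blast
  ultimately show "thin p B \<in> laver"
    unfolding laver_iff using tree_thin[OF p] by blast
qed

lemma shortest_split_extension_in_thin:
  assumes p: "tree p" and s: "s \<in> thin p B" and t: "t \<in> split_nodes p" "prefix s t"
    and shortest: "\<And>u. \<lbrakk>u \<in> split_nodes p; prefix s u\<rbrakk> \<Longrightarrow> length t \<le> length u"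
  shows "t \<in> thin p B"
proof -
  have "n \<in> B u" if u: "u \<in> split_nodes p" "prefix (u @ [n]) t" for u n
  proof -
    have "length u < length t"
      using prefix_length_le[OF u(2)] by simp
    then have "\<not> prefix s u"
      using shortest[OF u(1)] by linarith
    then have "prefix (u @ [n]) s"
      using t(2) u(2) by (metis prefix_same_cases prefix_snoc)
    with s u(1) show ?thesis
      by (simp add: thin_def)
  qed
  with t(1) show ?thesis
    by (simp add: thin_def split_nodes_def)
qed

lemma thinnable_miller: "thinnable miller"
  unfolding thinnable_def
proof (intro ballI conjI allI impI)
  fix p
  assume "p \<in> miller"
  then have p: "tree p" and split: "\<And>s. s \<in> p \<Longrightarrow> \<exists>t\<in>split_nodes p. prefix s t"
    unfolding miller_iff by blast+
  show "split_nodes p \<noteq> {}"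
    using split[OF Nil_in_tree[OF p]] by blast
  fix B
  assume B: "\<forall>s\<in>split_nodes p. infinite (Succ p s \<inter> B s)"
  have "\<exists>t\<in>split_nodes (thin p B). prefix s t" if s: "s \<in> thin p B" for s
  proof -
    have "\<exists>t. t \<in> split_nodes p \<and> prefix s t"
      using split s thin_subset by blast
    then obtain t where t: "t \<in> split_nodes p" "prefix s t"
      and "\<And>u. \<lbrakk>u \<in> split_nodes p; prefix s u\<rbrakk> \<Longrightarrow> length t \<le> length u"
      using ex_has_least_nat[of "\<lambda>t. t \<in> split_nodes p \<and> prefix s t" _ length] by blast
    then have "t \<in> thin p B"
      using shortest_split_extension_in_thin[OF p s] by blast
    with t show ?thesis
      unfolding split_nodes_thin[OF B] by blast
  qed
  then show "thin p B \<in> miller"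
    unfolding miller_iff using tree_thin[OF p] by blast
qed


section \<open>Collapsing the continuum\<close>

context colouring_system
begin

definition tree_colour :: "'i \<Rightarrow> 'c \<Rightarrow> nat list set \<Rightarrow> bool" where
  "tree_colour i z p \<longleftrightarrow> (\<forall>s\<in>split_nodes p. \<Phi> i (Succ p s) z)"

lemma tree_colour_mono:
  assumes "i \<in> I" "tree_colour i z q" "p \<subseteq> q"
  shows "tree_colour i z p"
  using assms(2) colour_hereditary[OF assms(1) _ Succ_mono[OF assms(3)]]
    split_nodes_mono[OF assms(3)]
  unfolding tree_colour_def by blast

lemma tree_colour_unique:
  assumes "i \<in> I" "split_nodes p \<noteq> {}" "tree_colour i z p" "tree_colour i z' p"
  shows "z = z'"
  using assms colour_unique[OF assms(1)] unfolding tree_colour_def split_nodes_def by blast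

lemma thin_to_tree_colour:
  obtains i B where "i \<in> I" "\<forall>s\<in>split_nodes p. infinite (Succ p s \<inter> B s)"
    "tree_colour i z (thin p B)"
proof -
  have "\<exists>i\<in>I. \<forall>N\<in>Succ p ` split_nodes p. \<forall>z. \<exists>M\<subseteq>N. infinite M \<and> \<Phi> i M z"
    by (rule all_colours_below) (auto simp: split_nodes_def)
  then obtain i where i: "i \<in> I"
    and "\<forall>s\<in>split_nodes p. \<exists>M\<subseteq>Succ p s. infinite M \<and> \<Phi> i M z"
    by blast
  then obtain B where
    B: "\<And>s. s \<in> split_nodes p \<Longrightarrow> B s \<subseteq> Succ p s \<and> infinite (B s) \<and> \<Phi> i (B s) z"
    by metis
  then have inf: "\<forall>s\<in>split_nodes p. infinite (Succ p s \<inter> B s)"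
    by (simp add: Int_absorb1)
  have "tree_colour i z (thin p B)"
    unfolding tree_colour_def split_nodes_thin[OF inf] using B by (simp add: Succ_thin Int_absorb1)
  with i inf show ?thesis
    by (rule that)
qed

lemma decided_surjection_tree_colour:
  assumes P: "thinnable P"
  shows "decided_surjection P (\<subseteq>) I UNIV tree_colour"
proof unfold_locales
  fix i z p
  assume i: "i \<in> I" and p: "p \<in> P"
  show "tree_colour i z p" if "tree_colour i z q" "p \<subseteq> q" for q
    using i that by (rule tree_colour_mono)
  have "split_nodes p \<noteq> {}"
    using P p by (simp add: thinnable_def)
  then show "z = z'" if "tree_colour i z p" "tree_colour i z' p" for z'
    using i that by (intro tree_colour_unique)
next
  fix z p
  assume p: "p \<in> P"
  obtain i B where i: "i \<in> I" and B: "\<forall>s\<in>split_nodes p. infinite (Succ p s \<inter> B s)"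
    and colour: "tree_colour i z (thin p B)"
    by (rule thin_to_tree_colour)
  have "thin p B \<in> P"
    using P p B by (simp add: thinnable_def)
  with i colour thin_subset show "\<exists>q\<in>P. q \<subseteq> p \<and> (\<exists>i\<in>I. tree_colour i z q)"
    by blast
qed auto

end

lemma kappa_le_cardinal_h:
  assumes "thinnable P"
  shows "kappa P (\<subseteq>) \<le>o \<hh>"
proof -
  obtain H :: "pfin set set" and \<Phi> :: "pfin set \<Rightarrow> nat set \<Rightarrow> nat set \<Rightarrow> bool"
    where "colouring_system H \<Phi>" and h: "\<hh> = |H|"
    using cardinal_h_colouring_system .
  then interpret colouring_system H \<Phi>
    by simp
  show ?thesis
    unfolding h using decided_surjection_tree_colour[OF assms] by (rule kappa_le_if_decided)
qed

theorem theorem2p7: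
  "kappa laver (\<subseteq>) \<le>o \<hh> \<and> kappa miller (\<subseteq>) \<le>o \<hh>"
  using kappa_le_cardinal_h[OF thinnable_laver] kappa_le_cardinal_h[OF thinnable_miller] ..

end
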